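(* For every integer $k\geq 0$ there exists a connected bipartite graph $G_k$ of order $2k+8$ such that: (1) $h(G_k)>\frac{n(G_k)}{2}=\alpha(G_k)$; (2) each $S\in\Omega(G_k)$ is a maximal annihilating set.
   Context: Graphs are finite, undirected, without loops or multiple edges. $n(G)=|V(G)|$ is the order and $m(G)=|E(G)|$. $\alpha(G)$ is the maximum size of an independent set of $G$, and $\Omega(G)$ is the family of all independent sets of size $\alpha(G)$. If $d_1\leq d_2\leq\cdots\leq d_n$ is the degree sequence of $G$, the annihilation number $h(G)$ is the largest integer $k$ (with $0\le k\le n$) such that $\sum_{i=1}^{k} d_i\leq m(G)$. For $A\subseteq V(G)$ let $\deg(A)=\sum_{v\in A}\deg(v)$. A set $A\subseteq V(G)$ is an annihilating set if $\deg(A)\leq m(G)$; an annihilating set $A$ is maximal if $\deg(A\cup\{v\})>m(G)$ for every $v\in V(G)-A$. *)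

theory Defs
  imports Complex_Main "HOL-Library.Multiset"
begin

text \<open>A graph is given by its vertex set \<open>V\<close> and its set \<open>E\<close> of edges, each edge being the
  two-element set of its end points (so there are no loops and no multiple edges).\<close>

definition finite_simple_graph :: "'a set \<Rightarrow> 'a set set \<Rightarrow> bool" where
  "finite_simple_graph V E \<longleftrightarrow> finite V \<and> (\<forall>e\<in>E. e \<subseteq> V \<and> card e = 2)"

definition graph_connected :: "'a set \<Rightarrow> 'a set set \<Rightarrow> bool" where
  "graph_connected V E \<longleftrightarrow>
     V \<noteq> {} \<and> (\<forall>u\<in>V. \<forall>v\<in>V. (u, v) \<in> {(x, y). {x, y} \<in> E}\<^sup>*)"

definition bipartite :: "'a set \<Rightarrow> 'a set set \<Rightarrow> bool" where
  "bipartite V E \<longleftrightarrow>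
     (\<exists>A B. A \<union> B = V \<and> A \<inter> B = {} \<and> (\<forall>e\<in>E. \<exists>a\<in>A. \<exists>b\<in>B. e = {a, b}))"

definition degree :: "'a set set \<Rightarrow> 'a \<Rightarrow> nat" where
  "degree E v = card {e \<in> E. v \<in> e}"

definition deg_sum :: "'a set set \<Rightarrow> 'a set \<Rightarrow> nat" where
  "deg_sum E A = (\<Sum>v\<in>A. degree E v)"

definition independent_set :: "'a set \<Rightarrow> 'a set set \<Rightarrow> 'a set \<Rightarrow> bool" where
  "independent_set V E S \<longleftrightarrow> S \<subseteq> V \<and> (\<forall>u\<in>S. \<forall>v\<in>S. {u, v} \<notin> E)"

definition independence_number :: "'a set \<Rightarrow> 'a set set \<Rightarrow> nat" where
  "independence_number V E = Max (card ` {S. independent_set V E S})"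

definition maximum_independent_sets :: "'a set \<Rightarrow> 'a set set \<Rightarrow> 'a set set" where
  "maximum_independent_sets V E =
     {S. independent_set V E S \<and> card S = independence_number V E}"

definition degree_sequence :: "'a set \<Rightarrow> 'a set set \<Rightarrow> nat list" where
  "degree_sequence V E = sorted_list_of_multiset (image_mset (degree E) (mset_set V))"

definition annihilation_number :: "'a set \<Rightarrow> 'a set set \<Rightarrow> nat" where
  "annihilation_number V E =
     Max {k. k \<le> card V \<and> sum_list (take k (degree_sequence V E)) \<le> card E}"

definition annihilating :: "'a set \<Rightarrow> 'a set set \<Rightarrow> 'a set \<Rightarrow> bool" where
  "annihilating V E A \<longleftrightarrow> A \<subseteq> V \<and> deg_sum E A \<le> card E"

definition maximal_annihilating :: "'a set \<Rightarrow> 'a set set \<Rightarrow> 'a set \<Rightarrow> bool" where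
  "maximal_annihilating V E A \<longleftrightarrow>
     annihilating V E A \<and> (\<forall>v\<in>V - A. deg_sum E (A \<union> {v}) > card E)"

end

theory Submission imports Defs begin

text \<open>
  Take the cycle on \<open>0, \<dots>, n - 1\<close> for an even \<open>n \<ge> 8\<close> and add the chords from \<open>0\<close> to \<open>3\<close> and
  from \<open>0\<close> to \<open>5\<close>. Both chords connect vertices of different parity, so the graph stays bipartite, and it
  has \<open>m = n + 2\<close> edges.

  An independent set \<open>S\<close> is disjoint from its shift along the cycle, so \<open>2 |S| \<le> n\<close>, and in case
  of equality \<open>S\<close> and its shift partition the vertices: \<open>S\<close> consists of every other vertex
  (\<open>independent_set_half_cycle\<close>, \<open>alternating_of_card_half\<close>). So the maximum independent sets are
  the two colour classes. Each edge has exactly one end in a colour class \<open>S\<close>, whence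
  \<open>deg(S) = m\<close>, and no vertex can be added because none is isolated
  (\<open>maximal_annihilating_of_exact_cover\<close>).

  The annihilation number is large because the chords raise \<open>m\<close> to \<open>n + 2\<close> but touch only three
  vertices. The other \<open>n - 3\<close> vertices have degree two, and \<open>n - 3 \<ge> n/2 + 1\<close>, so \<open>n/2 + 1\<close> of
  them have degree sum \<open>n + 2 = m\<close>. Sharing an end point between the chords is what makes this
  work already for \<open>n = 8\<close>. Finally, the size of any annihilating set is a lower bound for the
  annihilation number, since the smallest degrees have the smallest sum
  (\<open>card_annihilating_le_annihilation_number\<close>).
\<close>

section \<open>Annihilating sets and the annihilation number\<close>

text \<open>Exchange argument: the head of a sorted list is at most any chosen entry, so exchanging a
  chosen entry for the head does not increase the sum.\<close>

lemma sum_take_sorted_le_sum_submultiset: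
  fixes xs :: "nat list"
  assumes "sorted xs" and "M \<subseteq># mset xs"
  shows "sum_list (take (size M) xs) \<le> sum_mset M"
  using assms
proof (induction xs arbitrary: M)
  case Nil
  then show ?case by simp
next
  case (Cons x xs)
  show ?case
  proof (cases "M = {#}")
    case True
    then show ?thesis by simp
  next
    case False
    \<comment> \<open>The entry to exchange for \<open>x\<close>; when \<open>x\<close> itself is chosen, it has to be \<open>x\<close>, so that the
      remaining entries come from \<open>xs\<close>.\<close>
    define y where "y = (if x \<in># M then x else SOME y. y \<in># M)"
    have y: "y \<in># M"
      using False by (auto simp: y_def some_in_eq)
    then obtain M' where M: "M = add_mset y M'"
      by (metis insert_DiffM)
    have "y \<in> set (x # xs)"
      using Cons.prems(2) y by (metis mset_subset_eqD set_mset_mset)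
    then have "x \<le> y"
      using Cons.prems(1) by auto
    have "M' \<subseteq># mset xs"
    proof (cases "x \<in># M")
      case True
      then have "y = x" by (simp add: y_def)
      then show ?thesis using Cons.prems(2) M by simp
    next
      case False
      then have "M \<subseteq># mset xs"
        using Cons.prems(2)
        by (metis diff_single_trivial mset.simps(2) subset_eq_diff_conv add_mset_add_single)
      then show ?thesis
        using M by (metis mset_subset_eq_insertD subset_mset.less_imp_le)
    qed
    then have "sum_list (take (size M') xs) \<le> sum_mset M'"
      using Cons.IH Cons.prems(1) by simp
    then show ?thesis
      using M \<open>x \<le> y\<close> by simp
  qed
qed

lemma card_annihilating_le_annihilation_number:
  assumes "finite V" and "annihilating V E A"
  shows "card A \<le> annihilation_number V E"
proof -
  have "A \<subseteq> V" and sum: "deg_sum E A \<le> card E"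
    using assms(2) by (auto simp: annihilating_def)
  let ?M = "image_mset (degree E) (mset_set A)"
  have sub: "?M \<subseteq># mset (degree_sequence V E)"
    using \<open>A \<subseteq> V\<close> \<open>finite V\<close>
    by (simp add: degree_sequence_def image_mset_subseteq_mono subset_imp_msubset_mset_set)
  have "sum_list (take (size ?M) (degree_sequence V E)) \<le> sum_mset ?M"
    using sub by (intro sum_take_sorted_le_sum_submultiset) (simp_all add: degree_sequence_def)
  then have "sum_list (take (card A) (degree_sequence V E)) \<le> card E"
    using sum by (simp add: deg_sum_def sum_unfold_sum_mset)
  then show ?thesis
    unfolding annihilation_number_def
    using \<open>A \<subseteq> V\<close> \<open>finite V\<close> by (intro Max_ge) (auto intro: card_mono)
qed

text \<open>Counting incidences between \<open>S\<close> and the edges in two ways gives \<open>deg(S) = m\<close>.\<close>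

lemma deg_sum_of_exact_cover:
  assumes "finite E" and "finite S" and "\<And>e. e \<in> E \<Longrightarrow> card (e \<inter> S) = 1"
  shows "deg_sum E S = card E"
proof -
  have "deg_sum E S = (\<Sum>v\<in>S. \<Sum>e\<in>E. if v \<in> e then 1 else 0)"
    using assms(1) by (simp add: deg_sum_def degree_def sum.If_cases Int_def)
  also have "\<dots> = (\<Sum>e\<in>E. \<Sum>v\<in>S. if v \<in> e then 1 else 0)"
    by (rule sum.swap)
  also have "\<dots> = (\<Sum>e\<in>E. card (e \<inter> S))"
    using assms(2) by (intro sum.cong) (simp_all add: sum.If_cases Int_def conj_commute)
  also have "\<dots> = card E"
    using assms(3) by simp
  finally show ?thesis .
qed

text \<open>Since \<open>deg(S)\<close> meets the bound \<open>m\<close> exactly, any further vertex of positive degree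
  exceeds it.\<close>

lemma maximal_annihilating_of_exact_cover:
  assumes "finite E" and "finite V" and "S \<subseteq> V"
    and cover: "\<And>e. e \<in> E \<Longrightarrow> card (e \<inter> S) = 1"
    and no_isolated: "\<And>v. v \<in> V \<Longrightarrow> \<exists>e\<in>E. v \<in> e"
  shows "maximal_annihilating V E S"
proof -
  have "finite S"
    using assms(2,3) finite_subset by blast
  then have S: "deg_sum E S = card E"
    using assms(1) cover by (intro deg_sum_of_exact_cover)
  have "deg_sum E (S \<union> {v}) > card E" if v: "v \<in> V - S" for v
  proof -
    have "degree E v > 0"
      using no_isolated[of v] v \<open>finite E\<close> by (auto simp: degree_def card_gt_0_iff)
    then show ?thesis
      using S v \<open>finite S\<close> by (simp add: deg_sum_def)
  qed
  then show ?thesis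
    using S \<open>S \<subseteq> V\<close> by (simp add: maximal_annihilating_def annihilating_def)
qed

section \<open>Half-size independent sets in a cycle\<close>

lemma inj_on_cyclic_shift: "inj_on (\<lambda>i. Suc i mod n) {..<n}"
proof (rule inj_onI)
  fix i j
  assume "i \<in> {..<n}" "j \<in> {..<n}" "Suc i mod n = Suc j mod n"
  then show "i = j"
    by (auto simp: mod_Suc split: if_splits)
qed

text \<open>\<open>S\<close> and its shift are disjoint sets of the same size within the \<open>n\<close> vertices.\<close>

lemma independent_set_half_cycle:
  assumes "S \<subseteq> {..<n}" and "\<And>i. i \<in> S \<Longrightarrow> Suc i mod n \<notin> S"
  shows "2 * card S \<le> n"
    and "2 * card S = n \<Longrightarrow> S \<union> (\<lambda>i. Suc i mod n) ` S = {..<n}"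
proof -
  let ?T = "(\<lambda>i. Suc i mod n) ` S"
  have fin: "finite S"
    using assms(1) finite_subset by blast
  have T: "card ?T = card S"
    using inj_on_subset[OF inj_on_cyclic_shift assms(1)] by (rule card_image)
  have sub: "S \<union> ?T \<subseteq> {..<n}"
    using assms(1) by auto
  have "S \<inter> ?T = {}"
    using assms(2) by blast
  then have card: "card (S \<union> ?T) = 2 * card S"
    using fin T by (simp add: card_Un_disjoint)
  show "2 * card S \<le> n"
    using card_mono[OF _ sub] card by simp
  show "S \<union> ?T = {..<n}" if "2 * card S = n"
    using card_subset_eq[OF _ sub] card that by simp
qed

text \<open>As \<open>S\<close> and its shift cover the cycle, a vertex belongs to \<open>S\<close> exactly when its predecessor
  does not. The parity form makes the two possible sets the parity classes of the vertices.\<close>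

lemma alternating_of_card_half:
  assumes "S \<subseteq> {..<n}" and "\<And>i. i \<in> S \<Longrightarrow> Suc i mod n \<notin> S" and "2 * card S = n" and "i < n"
  shows "i \<in> S \<longleftrightarrow> (even i \<longleftrightarrow> 0 \<in> S)"
  using assms(4)
proof (induction i)
  case 0
  then show ?case by simp
next
  case (Suc i)
  have "Suc i \<in> S \<union> (\<lambda>i. Suc i mod n) ` S"
    using independent_set_half_cycle(2)[OF assms(1-3)] Suc.prems by simp
  moreover have "j = i" if "j \<in> S" "Suc i = Suc j mod n" for j
    using inj_onD[OF inj_on_cyclic_shift, of j n i] that Suc.prems assms(1) by auto
  ultimately have "Suc i \<in> S \<or> i \<in> S"
    by auto
  moreover have "i \<in> S \<Longrightarrow> Suc i \<notin> S"
    using assms(2)[of i] Suc.prems by simp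
  ultimately show ?case
    using Suc.IH Suc.prems by auto
qed

section \<open>The even cycle with two chords from one vertex\<close>

text \<open>The closing edge \<open>{0, n - 1}\<close> of the cycle is listed with the chords, as a third edge at \<open>0\<close>. For
  \<open>n \<ge> 8\<close> the three are distinct, and no index has to be reduced modulo \<open>n\<close>.\<close>

definition chorded_cycle :: "nat \<Rightarrow> nat set set" where
  "chorded_cycle n = (\<lambda>i. {i, Suc i}) ` {..<n - 1} \<union> (\<lambda>j. {0, j}) ` {3, 5, n - 1}"

lemma finite_chorded_cycle: "finite (chorded_cycle n)"
  by (simp add: chorded_cycle_def)

lemma chorded_cycle_edgeE:
  assumes "e \<in> chorded_cycle n" and "even n" and "n \<ge> 8"
  obtains i j where "e = {i, j}" "i < n" "j < n" "even i" "odd j"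
proof -
  consider (path) i where "i < n - 1" "e = {i, Suc i}"
    | (hub) j where "j \<in> {3, 5, n - 1}" "e = {0, j}"
    using assms(1) by (auto simp: chorded_cycle_def)
  then show ?thesis
  proof cases
    case path
    then show ?thesis
      using that[of i "Suc i"] that[of "Suc i" i] by (cases "even i") (auto simp: insert_commute)
  next
    case hub
    moreover have "odd j"
      using hub(1) assms(2,3) by auto
    ultimately show ?thesis
      using that[of 0 j] assms(3) by auto
  qed
qed

lemma card_chorded_cycle:
  assumes "n \<ge> 8"
  shows "card (chorded_cycle n) = n + 2"
proof -
  have "inj_on (\<lambda>i. {i, Suc i}) {..<n - 1}"
    by (auto simp: inj_on_def doubleton_eq_iff)
  then have path: "card ((\<lambda>i. {i, Suc i}) ` {..<n - 1}) = n - 1"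
    by (simp add: card_image)
  have "inj_on (\<lambda>j. {0 :: nat, j}) {3, 5, n - 1}"
    by (auto simp: inj_on_def doubleton_eq_iff)
  then have hub: "card ((\<lambda>j. {0 :: nat, j}) ` {3, 5, n - 1}) = 3"
    using assms by (subst card_image) auto
  have "(\<lambda>i. {i, Suc i}) ` {..<n - 1} \<inter> (\<lambda>j. {0, j}) ` {3, 5, n - 1} = {}"
    using assms by (auto simp: doubleton_eq_iff)
  then have "card (chorded_cycle n) = n - 1 + 3"
    unfolding chorded_cycle_def using path hub by (subst card_Un_disjoint) simp_all
  then show ?thesis
    using assms by simp
qed

lemma cycle_edge_in_chorded_cycle:
  assumes "i < n" and "n \<ge> 8"
  shows "{i, Suc i mod n} \<in> chorded_cycle n"
proof (cases "Suc i = n")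
  case True
  then have "{i, Suc i mod n} = {0, n - 1}" by auto
  then show ?thesis by (simp add: chorded_cycle_def)
next
  case False
  then show ?thesis using assms by (auto simp: chorded_cycle_def)
qed

lemma simple_chorded_cycle:
  assumes "even n" and "n \<ge> 8"
  shows "finite_simple_graph {..<n} (chorded_cycle n)"
  unfolding finite_simple_graph_def
proof (intro conjI ballI)
  fix e assume "e \<in> chorded_cycle n"
  then obtain i j where "e = {i, j}" "i < n" "j < n" "even i" "odd j"
    using chorded_cycle_edgeE assms by blast
  moreover from this have "i \<noteq> j" by auto
  ultimately show "e \<subseteq> {..<n}" "card e = 2" by auto
qed simp

lemma connected_chorded_cycle:
  assumes "n \<ge> 8"
  shows "graph_connected {..<n} (chorded_cycle n)"
proof -
  let ?R = "{(x, y). {x, y} \<in> chorded_cycle n}"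
  have from_0: "(0, i) \<in> ?R\<^sup>*" if "i < n" for i
    using that
  proof (induction i)
    case 0
    then show ?case by simp
  next
    case (Suc i)
    then have "(i, Suc i) \<in> ?R"
      using cycle_edge_in_chorded_cycle[of i n] assms by simp
    then show ?case
      using Suc by (meson Suc_lessD rtrancl.rtrancl_into_rtrancl)
  qed
  have "sym (?R\<^sup>*)"
    by (intro sym_rtrancl) (auto simp: sym_def insert_commute)
  then have "(u, v) \<in> ?R\<^sup>*" if "u < n" "v < n" for u v
    using from_0[OF that(1)] from_0[OF that(2)] by (meson symD rtrancl_trans)
  then show ?thesis
    using assms by (auto simp: graph_connected_def lessThan_empty_iff)
qed

lemma bipartite_chorded_cycle:
  assumes "even n" and "n \<ge> 8"
  shows "bipartite {..<n} (chorded_cycle n)"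
  unfolding bipartite_def
proof (intro exI conjI ballI)
  fix e assume "e \<in> chorded_cycle n"
  then show "\<exists>a\<in>{i. i < n \<and> even i}. \<exists>b\<in>{i. i < n \<and> odd i}. e = {a, b}"
    using assms by (elim chorded_cycle_edgeE) auto
qed auto

lemma degree_chorded_cycle_le_2:
  assumes "v < n" and "v \<notin> {0, 3, 5}"
  shows "degree (chorded_cycle n) v \<le> 2"
proof -
  have "{e \<in> chorded_cycle n. v \<in> e} \<subseteq> {{v - 1, v}, {v, Suc v mod n}}"
    using assms by (auto simp: chorded_cycle_def doubleton_eq_iff)
  then have "degree (chorded_cycle n) v \<le> card {{v - 1, v}, {v, Suc v mod n}}"
    unfolding degree_def by (intro card_mono) auto
  also have "\<dots> \<le> 2"
    by (simp add: card_insert_if)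
  finally show ?thesis .
qed

lemma annihilation_number_chorded_cycle:
  assumes "even n" and "n \<ge> 8"
  shows "annihilation_number {..<n} (chorded_cycle n) \<ge> n div 2 + 1"
proof -
  have "card ({..<n} - {0, 3, 5}) = n - 3"
    using assms(2) by (subst card_Diff_subset) auto
  then have "n div 2 + 1 \<le> card ({..<n} - {0, 3, 5})"
    using assms by simp
  then obtain A where A: "A \<subseteq> {..<n} - {0, 3, 5}" "card A = n div 2 + 1"
    by (meson obtain_subset_with_card_n)
  have "deg_sum (chorded_cycle n) A \<le> of_nat (card A) * 2"
    unfolding deg_sum_def
    using A(1) by (intro sum_bounded_above degree_chorded_cycle_le_2) auto
  also have "\<dots> = card (chorded_cycle n)"
    using A(2) assms by (simp add: card_chorded_cycle)
  finally have "annihilating {..<n} (chorded_cycle n) A"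
    using A(1) by (auto simp: annihilating_def)
  then show ?thesis
    using card_annihilating_le_annihilation_number[of "{..<n}"] A(2) by fastforce
qed

lemma independent_chorded_cycle_shift:
  assumes "independent_set {..<n} (chorded_cycle n) S" and "n \<ge> 8" and "i \<in> S"
  shows "Suc i mod n \<notin> S"
  using assms cycle_edge_in_chorded_cycle[of i n] by (auto simp: independent_set_def)

lemma independence_number_chorded_cycle:
  assumes "even n" and "n \<ge> 8"
  shows "independence_number {..<n} (chorded_cycle n) = n div 2"
  unfolding independence_number_def
proof (rule Max_eqI)
  have "{S. independent_set {..<n} (chorded_cycle n) S} \<subseteq> Pow {..<n}"
    by (auto simp: independent_set_def)
  then show "finite (card ` {S. independent_set {..<n} (chorded_cycle n) S})"
    by (intro finite_imageI) (auto intro: finite_subset)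
next
  fix c assume "c \<in> card ` {S. independent_set {..<n} (chorded_cycle n) S}"
  then obtain S where S: "independent_set {..<n} (chorded_cycle n) S" "c = card S"
    by auto
  then have "2 * card S \<le> n"
    using independent_chorded_cycle_shift assms(2)
    by (intro independent_set_half_cycle(1)) (auto simp: independent_set_def)
  then show "c \<le> n div 2"
    using S(2) by simp
next
  let ?S = "(\<lambda>i. 2 * i) ` {..<n div 2}"
  have "{u, v} \<notin> chorded_cycle n" if "u \<in> ?S" "v \<in> ?S" for u v
  proof
    assume "{u, v} \<in> chorded_cycle n"
    then show False
      using that assms by (elim chorded_cycle_edgeE) (auto simp: doubleton_eq_iff)
  qed
  then have "independent_set {..<n} (chorded_cycle n) ?S"
    by (auto simp: independent_set_def)
  moreover have "card ?S = n div 2"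
    by (simp add: card_image inj_on_def)
  ultimately show "n div 2 \<in> card ` {S. independent_set {..<n} (chorded_cycle n) S}"
    by (metis imageI mem_Collect_eq)
qed

lemma maximal_annihilating_chorded_cycle:
  assumes "even n" and "n \<ge> 8"
    and "S \<in> maximum_independent_sets {..<n} (chorded_cycle n)"
  shows "maximal_annihilating {..<n} (chorded_cycle n) S"
proof -
  have ind: "independent_set {..<n} (chorded_cycle n) S" and card: "2 * card S = n"
    using assms independence_number_chorded_cycle by (auto simp: maximum_independent_sets_def)
  have sub: "S \<subseteq> {..<n}"
    using ind by (simp add: independent_set_def)
  have alt: "i \<in> S \<longleftrightarrow> (even i \<longleftrightarrow> 0 \<in> S)" if "i < n" for i
    using alternating_of_card_half[OF sub _ card that]
      independent_chorded_cycle_shift[OF ind assms(2)] by blast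
  show ?thesis
  proof (rule maximal_annihilating_of_exact_cover)
    fix e assume "e \<in> chorded_cycle n"
    then obtain i j where "e = {i, j}" "i < n" "j < n" "even i" "odd j"
      using chorded_cycle_edgeE assms by blast
    moreover from this have "i \<in> S \<longleftrightarrow> 0 \<in> S" and "j \<in> S \<longleftrightarrow> 0 \<notin> S"
      using alt[of i] alt[of j] by simp_all
    ultimately have "e \<inter> S = (if 0 \<in> S then {i} else {j})"
      by (cases "0 \<in> S") simp_all
    then show "card (e \<inter> S) = 1"
      by simp
  next
    fix v assume "v \<in> {..<n}"
    then show "\<exists>e\<in>chorded_cycle n. v \<in> e"
      using cycle_edge_in_chorded_cycle[of v n] assms(2) by blast
  qed (use sub finite_chorded_cycle in simp_all)
qed

theorem theorem4p2:
  fixes k :: nat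
  shows "\<exists>(V :: nat set) (E :: nat set set).
           finite_simple_graph V E \<and> graph_connected V E \<and> bipartite V E \<and>
           card V = 2 * k + 8 \<and>
           real (annihilation_number V E) > real (card V) / 2 \<and>
           real (card V) / 2 = real (independence_number V E) \<and>
           (\<forall>S \<in> maximum_independent_sets V E. maximal_annihilating V E S)"
proof -
  define n where "n = 2 * k + 8"
  have n: "even n" "n \<ge> 8"
    by (simp_all add: n_def)
  have "real (annihilation_number {..<n} (chorded_cycle n)) > real n / 2"
    using annihilation_number_chorded_cycle[OF n] n(1) by linarith
  moreover have "real n / 2 = real (independence_number {..<n} (chorded_cycle n))"
    using independence_number_chorded_cycle[OF n] n(1) by (simp add: real_of_nat_div)
  ultimately show ?thesis
    using simple_chorded_cycle[OF n] connected_chorded_cycle[OF n(2)] bipartite_chorded_cycle[OF n]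
      maximal_annihilating_chorded_cycle[OF n]
    by (intro exI[of _ "{..<n}"] exI[of _ "chorded_cycle n"]) (simp add: n_def)
qed

end
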